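(* Let $\mu$ be a $\sigma$-finite measure over $X$, $\nu$ be a $\sigma$-finite measure over $Y$ and $S\subset X\times Y$ be a $\mu\times\nu$-measurable set. Then $S$ is $\mu\times\nu$-trivial if and only if $\mu$-almost every fiber $S_x$ is $\nu$-trivial and $\nu$-almost every fiber $S^y$ is $\mu$-trivial.
   Context: Let $X$ and $Y$ be two non-empty sets and $S\subset X\times Y$. For $x\in X$, the fiber of $S$ through $x$ is $S_x:=\{y\in Y:(x,y)\in S\}$; for $y\in Y$, the fiber of $S$ through $y$ is $S^y:=\{x\in X:(x,y)\in S\}$. Given a measure $\mu$ over $X$, a set $A\subset X$ is called $\mu$-trivial if $\mu(A)=0$ or $\mu(X\setminus A)=0$ (and analogously for $\nu$ over $Y$ and for $\mu\times\nu$ over $X\times Y$). *)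

theory Defs
  imports "HOL-Analysis.Analysis"
begin

text \<open>
  Being null and being measurable are understood with respect to the completed measure. Membership
  in \<open>null_sets\<close> is needed because \<open>emeasure\<close> is also \<open>0\<close> on non-measurable sets. For
  \<open>A \<in> sets M\<close> the condition is \<open>emeasure M A = 0 \<or> emeasure M (space M - A) = 0\<close>.
\<close>

definition trivial_set :: "'a measure \<Rightarrow> 'a set \<Rightarrow> bool" where
  "trivial_set M A \<longleftrightarrow> A \<subseteq> space M \<and>
     (A \<in> null_sets (completion M) \<or> space M - A \<in> null_sets (completion M))"

definition x_fiber :: "'b set \<Rightarrow> ('a \<times> 'b) set \<Rightarrow> 'a \<Rightarrow> 'b set" where
  "x_fiber Y S x = {y \<in> Y. (x, y) \<in> S}"

definition y_fiber :: "'a set \<Rightarrow> ('a \<times> 'b) set \<Rightarrow> 'b \<Rightarrow> 'a set" where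
  "y_fiber X S y = {x \<in> X. (x, y) \<in> S}"

end

theory Submission
  imports Defs
begin

text \<open>
  Write \<open>B x\<close> and \<open>D y\<close> for the statements that the fibers \<open>S\<^sub>x\<close> and \<open>S\<^sup>y\<close> are not null.
  If almost all fibers are trivial, then almost everywhere \<open>(x, y) \<in> S \<longleftrightarrow> B x\<close> and
  \<open>(x, y) \<in> S \<longleftrightarrow> D y\<close>, hence \<open>B x \<longleftrightarrow> D y\<close>. So both sides are almost everywhere constant,
  with the same value, and \<open>S\<close> is null or conull accordingly.
\<close>

text \<open>Triviality survives a change on a null set; this is what later allows \<open>S\<close>
  to be exchanged for a measurable \<open>T\<close>, and a fiber for its defining predicate.\<close>

lemma AE_trivial_cong:
  assumes "AE x in M. P x \<longleftrightarrow> Q x"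
  shows "(AE x in M. \<not> P x) \<or> (AE x in M. P x) \<longleftrightarrow> (AE x in M. \<not> Q x) \<or> (AE x in M. Q x)"
proof -
  have "(AE x in M. P x) \<longleftrightarrow> (AE x in M. Q x)" "(AE x in M. \<not> P x) \<longleftrightarrow> (AE x in M. \<not> Q x)"
    using assms by (auto elim: eventually_elim2)
  then show ?thesis by simp
qed

text \<open>Both a null set of the completion and the exceptional set of an \<open>AE\<close>
  statement are merely contained in a null set of \<open>M\<close>. So the completion disappears,
  and no measurability of \<open>A\<close> is needed.\<close>

lemma trivial_set_iff_AE:
  assumes "A \<subseteq> space M"
  shows "trivial_set M A \<longleftrightarrow> (AE x in M. x \<notin> A) \<or> (AE x in M. x \<in> A)"
proof -
  have null: "C \<in> null_sets (completion M) \<longleftrightarrow> (AE x in M. x \<notin> C)" if "C \<subseteq> space M" for C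
  proof -
    have "{x \<in> space M. \<not> x \<notin> C} = C"
      using that by auto
    then show ?thesis
      by (simp add: null_sets_completion_iff2 eventually_ae_filter)
  qed
  have "(AE x in M. x \<notin> space M - A) \<longleftrightarrow> (AE x in M. x \<in> A)"
    by (rule AE_cong) auto
  then show ?thesis
    using assms null[of A] null[of "space M - A"] by (auto simp: trivial_set_def)
qed

lemma trivial_set_x_fiber_iff_AE:
  "trivial_set N (x_fiber (space N) S x) \<longleftrightarrow>
    (AE y in N. (x, y) \<notin> S) \<or> (AE y in N. (x, y) \<in> S)"
proof -
  have "AE y in N. y \<in> x_fiber (space N) S x \<longleftrightarrow> (x, y) \<in> S"
    by (rule AE_I2) (simp add: x_fiber_def)
  moreover have "x_fiber (space N) S x \<subseteq> space N"
    by (auto simp: x_fiber_def)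
  ultimately show ?thesis
    by (simp add: trivial_set_iff_AE AE_trivial_cong)
qed

lemma trivial_set_y_fiber_iff_AE:
  "trivial_set M (y_fiber (space M) S y) \<longleftrightarrow>
    (AE x in M. (x, y) \<notin> S) \<or> (AE x in M. (x, y) \<in> S)"
proof -
  have "AE x in M. x \<in> y_fiber (space M) S y \<longleftrightarrow> (x, y) \<in> S"
    by (rule AE_I2) (simp add: y_fiber_def)
  moreover have "y_fiber (space M) S y \<subseteq> space M"
    by (auto simp: y_fiber_def)
  ultimately show ?thesis
    by (simp add: trivial_set_iff_AE AE_trivial_cong)
qed

text \<open>Exchanging \<open>AE\<close> quantifiers requires measurability in the uncompleted
  product, so a set of the completion is first replaced by its measurable part.\<close>

lemma completion_AE_eq:
  assumes "S \<in> sets (completion M)"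
  obtains T where "T \<in> sets M" "AE z in M. z \<in> S \<longleftrightarrow> z \<in> T"
proof -
  obtain T A C where *: "S = T \<union> A" "A \<subseteq> C" "C \<in> null_sets M" "T \<in> sets M"
    using assms by (rule sets_completionE)
  have "AE z in M. z \<in> S \<longleftrightarrow> z \<in> T"
    using AE_not_in[OF *(3)] by eventually_elim (use *(1,2) in auto)
  with *(4) show thesis by (rule that)
qed

context pair_sigma_finite
begin

text \<open>The property is pulled back along the coordinate swap, which preserves the product
  measure. Unlike an appeal to \<open>AE_commute\<close>, this works for \<open>P\<close> that need
  not be measurable.\<close>

lemma AE_pair_swap:
  assumes "AE z in M1 \<Otimes>\<^sub>M M2. P z"
  shows "AE y in M2. AE x in M1. P (x, y)"
proof -
  interpret Q: pair_sigma_finite M2 M1 ..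
  have "AE z in distr (M2 \<Otimes>\<^sub>M M1) (M1 \<Otimes>\<^sub>M M2) (\<lambda>(x, y). (y, x)). P z"
    using arg_cong[OF distr_pair_swap, of "\<lambda>K. AE z in K. P z"] assms by (rule iffD1)
  then have "AE z in M2 \<Otimes>\<^sub>M M1. P ((\<lambda>(x, y). (y, x)) z)"
    by (rule AE_distrD[OF measurable_pair_swap'])
  from Q.AE_pair[OF this] show ?thesis by simp
qed

lemma AE_fibers_imp_AE_pair:
  assumes T: "T \<in> sets (M1 \<Otimes>\<^sub>M M2)"
    and x: "AE x in M1. (AE y in M2. (x, y) \<notin> T) \<or> (AE y in M2. (x, y) \<in> T)"
    and y: "AE y in M2. (AE x in M1. (x, y) \<notin> T) \<or> (AE x in M1. (x, y) \<in> T)"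
  shows "(AE z in M1 \<Otimes>\<^sub>M M2. z \<notin> T) \<or> (AE z in M1 \<Otimes>\<^sub>M M2. z \<in> T)"
proof -
  define B where "B x \<longleftrightarrow> \<not> (AE y in M2. (x, y) \<notin> T)" for x
  define D where "D y \<longleftrightarrow> \<not> (AE x in M1. (x, y) \<notin> T)" for y
  note [measurable] = T
  \<comment> \<open>Rewriting \<open>D\<close> through the measure of the fibers makes it
    measurable, as the exchange of quantifiers in \<open>yD\<close> below requires.\<close>
  have D_eq: "D y \<longleftrightarrow> emeasure M1 ((\<lambda>x. (x, y)) -` T) \<noteq> 0" for y
    using AE_iff_null_sets[OF sets_Pair2[OF T], of y] sets_Pair2[OF T, of y]
    by (simp add: D_def null_sets_def)
  have [measurable]: "Measurable.pred M2 D"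
    unfolding D_eq using measurable_emeasure_Pair2[OF T] by measurable
  have xB: "AE x in M1. AE y in M2. (x, y) \<in> T \<longleftrightarrow> B x"
    using x
  proof eventually_elim
    case (elim x)
    then show ?case by (cases "B x") (simp_all add: B_def)
  qed
  have yD: "AE y in M2. AE x in M1. (x, y) \<in> T \<longleftrightarrow> D y"
    using y
  proof eventually_elim
    case (elim y)
    then show ?case by (cases "D y") (simp_all add: D_def)
  qed
  \<comment> \<open>With the quantifiers of \<open>yD\<close> exchanged, both descriptions of
    \<open>T\<close> hold in the same order and can be compared.\<close>
  have "AE x in M1. AE y in M2. (x, y) \<in> T \<longleftrightarrow> D y"
    by (rule AE_commute[THEN iffD2, OF _ yD]) measurable
  with xB have BD: "AE x in M1. AE y in M2. B x \<longleftrightarrow> D y"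
  proof eventually_elim
    case (elim x)
    then show ?case by eventually_elim simp
  qed
  show ?thesis
  proof (cases "AE x in M1. \<not> B x")
    case True
    with xB have "AE x in M1. AE y in M2. (x, y) \<notin> T"
      by eventually_elim simp
    then have "AE z in M1 \<Otimes>\<^sub>M M2. z \<notin> T"
      by (rule AE_pair_measure[rotated]) measurable
    then show ?thesis ..
  next
    case False
    \<comment> \<open>The points satisfying \<open>B\<close> do not lie in a null set, so one of
      them avoids the exceptional set of \<open>BD\<close>. This single \<open>x\<close> forces
      \<open>D y\<close> for almost every \<open>y\<close>.\<close>
    obtain x where "B x" "AE y in M2. B x \<longleftrightarrow> D y"
    proof (rule ccontr)
      assume "\<not> thesis"
      with that have nex: "\<not> (B x \<and> (AE y in M2. B x \<longleftrightarrow> D y))" for x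
        by blast
      have "AE x in M1. \<not> B x"
        using BD
      proof (rule eventually_mono)
        show "\<not> B x" if "AE y in M2. B x \<longleftrightarrow> D y" for x
          using that nex[of x] by blast
      qed
      with False show False ..
    qed
    then have "AE y in M2. D y"
      by simp
    with yD have "AE y in M2. AE x in M1. (x, y) \<in> T"
      by eventually_elim simp
    then have "AE x in M1. AE y in M2. (x, y) \<in> T"
      by (rule AE_commute[THEN iffD2, rotated]) measurable
    then have "AE z in M1 \<Otimes>\<^sub>M M2. z \<in> T"
      by (rule AE_pair_measure[rotated]) measurable
    then show ?thesis ..
  qed
qed

lemma AE_pair_trivial_iff_fibers:
  assumes S: "S \<in> sets (completion (M1 \<Otimes>\<^sub>M M2))"
  shows "(AE z in M1 \<Otimes>\<^sub>M M2. z \<notin> S) \<or> (AE z in M1 \<Otimes>\<^sub>M M2. z \<in> S) \<longleftrightarrow>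
    (AE x in M1. (AE y in M2. (x, y) \<notin> S) \<or> (AE y in M2. (x, y) \<in> S)) \<and>
    (AE y in M2. (AE x in M1. (x, y) \<notin> S) \<or> (AE x in M1. (x, y) \<in> S))"
    (is "?null \<or> ?conull \<longleftrightarrow> ?fibers")
proof
  assume "?null \<or> ?conull"
  then show ?fibers
  proof
    assume ?null
    from AE_pair[OF this] AE_pair_swap[OF this] show ?fibers
      by (blast intro: eventually_mono)
  next
    assume ?conull
    from AE_pair[OF this] AE_pair_swap[OF this] show ?fibers
      by (blast intro: eventually_mono)
  qed
next
  assume fibers: ?fibers
  obtain T where T: "T \<in> sets (M1 \<Otimes>\<^sub>M M2)" and ST: "AE z in M1 \<Otimes>\<^sub>M M2. z \<in> S \<longleftrightarrow> z \<in> T"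
    using completion_AE_eq[OF S] .
  have "(AE z in M1 \<Otimes>\<^sub>M M2. z \<notin> T) \<or> (AE z in M1 \<Otimes>\<^sub>M M2. z \<in> T)"
  proof (rule AE_fibers_imp_AE_pair[OF T])
    \<comment> \<open>For almost every \<open>x\<close> the fibers of \<open>S\<close> and
      \<open>T\<close> agree almost everywhere, so triviality passes from one to the other.\<close>
    show "AE x in M1. (AE y in M2. (x, y) \<notin> T) \<or> (AE y in M2. (x, y) \<in> T)"
      using AE_pair[OF ST] conjunct1[OF fibers]
      by eventually_elim (rule AE_trivial_cong[THEN iffD1])
    show "AE y in M2. (AE x in M1. (x, y) \<notin> T) \<or> (AE x in M1. (x, y) \<in> T)"
      using AE_pair_swap[OF ST] conjunct2[OF fibers]
      by eventually_elim (rule AE_trivial_cong[THEN iffD1])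
  qed
  then show "?null \<or> ?conull"
    by (rule AE_trivial_cong[OF ST, THEN iffD2])
qed

end

theorem theorem3:
  fixes M :: "'a measure" and N :: "'b measure" and S :: "('a \<times> 'b) set"
  assumes "space M \<noteq> {}" and "space N \<noteq> {}"
    and "sigma_finite_measure M" and "sigma_finite_measure N"
    and "S \<in> sets (completion (M \<Otimes>\<^sub>M N))"
  shows "trivial_set (M \<Otimes>\<^sub>M N) S \<longleftrightarrow>
    (AE x in M. trivial_set N (x_fiber (space N) S x)) \<and>
    (AE y in N. trivial_set M (y_fiber (space M) S y))"
proof -
  interpret pair_sigma_finite M N
    using assms(3,4) by (rule pair_sigma_finite.intro)
  have "S \<subseteq> space (M \<Otimes>\<^sub>M N)"
    using sets.sets_into_space[OF assms(5)] by simp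
  then show ?thesis
    using AE_pair_trivial_iff_fibers[OF assms(5)]
    by (simp add: trivial_set_iff_AE trivial_set_x_fiber_iff_AE trivial_set_y_fiber_iff_AE)
qed

end
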